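(* Let $V(4)$ be the stationary speed of the $N$-counter system with $N=4$ counters. Then $$\frac{26}{19}\le V(4)\le \frac{10}{7}.$$
   Context: The $4$-counter system: there are $4$ counters taking integer values. At every time step $t=0,1,2,\ldots$ an (unordered) pair of distinct counters is selected uniformly at random among the $6$ pairs, independently over steps. If the states of the two selected counters are different, the smaller one is increased by $1$; if they are equal, both are increased by $1$. It is assumed that the system starts from a configuration with at least two counters at the highest level; then at all times there are at least two counters at the highest level. Gap process: order the counters from largest to smallest; let $X_1(t)\ge 0$ be the difference between the values of the second and third largest counters and $X_2(t)\ge 0$ the difference between the third and fourth largest counters, after $t$ steps. Then $(X_1(t),X_2(t))$ is a positive recurrent Markov chain on $\mathbb{Z}_+^2$; its transition probabilities $p(\cdot,\cdot)$ are: $p((0,0),(1,0))=1$; for $k\ge1$, $p((k,0),(k+1,0))=p((k,0),(k-1,0))=\frac16$ and $p((k,0),(k-1,1))=\frac23$; for $l\ge 1$, $p((0,l),(0,l-1))=p((0,l),(1,l))=\frac12$; for $k,l\ge1$, $p((k,l),(k+1,l))=\frac16$, $p((k,l),(k,l-1))=\frac12$, $p((k,l),(k-1,l+1))=\frac13$. Let $\pi$ be its stationary distribution. Speed: $V(4)$ is the expected number of counters updated (increased) in one time step when the gap process is started from $\pi$. Explicitly, $$V(4)=1+\pi(\{(0,0)\})+\tfrac13\,\pi(\{(k,0):k\ge1\})+\tfrac12\,\pi(\{(0,l):l\ge1\})+\tfrac16\,\pi(\{(k,l):k,l\ge1\}).$$ *)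

theory Defs
  imports "HOL-Probability.Probability"
begin

type_synonym config = "nat \<Rightarrow> int"

definition counters :: "nat set" where
  "counters = {..<4}"

definition counter_pairs :: "nat set set" where
  "counter_pairs = {S. S \<subseteq> counters \<and> card S = 2}"

(* The smaller of the two selected counters, or both of them if they are equal. *)
definition updated :: "config \<Rightarrow> nat set \<Rightarrow> nat set" where
  "updated x S = {i \<in> S. \<forall>j\<in>S. x i \<le> x j}"

definition update :: "config \<Rightarrow> nat set \<Rightarrow> config" where
  "update x S = (\<lambda>i. if i \<in> updated x S then x i + 1 else x i)"

definition counter_step :: "config \<Rightarrow> config pmf" where
  "counter_step x = map_pmf (update x) (pmf_of_set counter_pairs)"

(* Values in increasing order: index 3 is the largest, index 0 the fourth largest. *)
definition levels :: "config \<Rightarrow> int list" where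
  "levels x = sort (map x [0..<4])"

definition two_at_top :: "config \<Rightarrow> bool" where
  "two_at_top x \<longleftrightarrow> levels x ! 2 = levels x ! 3"

definition gaps :: "config \<Rightarrow> nat \<times> nat" where
  "gaps x = (nat (levels x ! 2 - levels x ! 1), nat (levels x ! 1 - levels x ! 0))"

(* A representative configuration with two counters at the top and prescribed gaps.
   The choice is immaterial by gap_kernel_counter_step and mean_updates_representative below. *)
definition config_of_gaps :: "nat \<times> nat \<Rightarrow> config" where
  "config_of_gaps g = (\<lambda>i. [int (fst g + snd g), int (fst g + snd g), int (snd g), 0] ! i)"

definition gap_kernel :: "nat \<times> nat \<Rightarrow> (nat \<times> nat) pmf" where
  "gap_kernel g = map_pmf gaps (counter_step (config_of_gaps g))"

definition mean_updates :: "config \<Rightarrow> real" where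
  "mean_updates x =
     measure_pmf.expectation (pmf_of_set counter_pairs) (\<lambda>S. real (card (updated x S)))"

definition is_stationary :: "('a \<Rightarrow> 'a pmf) \<Rightarrow> 'a pmf \<Rightarrow> bool" where
  "is_stationary K \<mu> \<longleftrightarrow> bind_pmf \<mu> K = \<mu>"

definition gap_stationary :: "(nat \<times> nat) pmf" where
  "gap_stationary = (THE \<mu>. is_stationary gap_kernel \<mu>)"

definition V4 :: real where
  "V4 = measure_pmf.expectation gap_stationary (\<lambda>g. mean_updates (config_of_gaps g))"


lemma counter_pairs_eq:
  "counter_pairs = {{0,1},{0,2},{0,3},{1,2},{1,3},{2,3}}"
proof -
  have sub: "{0..<4::nat} = {0,1,2,3}"
    by auto
  show ?thesis
  proof (intro equalityI subsetI)
    fix S assume "S \<in> counter_pairs"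
    then obtain a b where "S = {a, b}" "a \<noteq> b" "a \<in> {0,1,2,3}" "b \<in> {0,1,2,3}"
      unfolding counter_pairs_def counters_def lessThan_atLeast0 sub card_2_iff by auto
    then show "S \<in> {{0,1},{0,2},{0,3},{1,2},{1,3},{2,3}}"
      by (elim insertE emptyE; simp add: insert_commute)
  next
    fix S assume "S \<in> {{0,1},{0,2},{0,3},{1,2},{1,3},{2,3::nat}}"
    then show "S \<in> counter_pairs"
      by (elim insertE emptyE; simp add: counter_pairs_def counters_def)
  qed
qed

lemma card_counter_pairs: "card counter_pairs = 6"
  by (simp add: counter_pairs_eq doubleton_eq_iff)

lemma finite_counter_pairs: "finite counter_pairs" "counter_pairs \<noteq> {}"
  by (simp_all add: counter_pairs_eq)

lemma sum_counter_pairs: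
  "sum f counter_pairs = f {0,1} + f {0,2} + f {0,3} + f {1,2} + f {1,3} + (f {2,3} :: real)"
  by (simp add: counter_pairs_eq doubleton_eq_iff)

lemma updated_pair:
  "updated x {i,j} = (if x i < x j then {i} else if x j < x i then {j} else {i,j})"
  by (auto simp: updated_def)

lemma levels_eq: "levels x = sort [x 0, x 1, x 2, x 3]"
  by (simp add: levels_def upt_rec numeral_eq_Suc)

lemma pmf_gap_kernel:
  "pmf (gap_kernel g) h =
     (\<Sum>S\<in>counter_pairs. if gaps (update (config_of_gaps g) S) = h then 1 else 0) / 6"
proof -
  have "pmf (gap_kernel g) h =
    card (counter_pairs \<inter> (\<lambda>S. gaps (update (config_of_gaps g) S)) -` {h}) / 6"
    by (simp add: gap_kernel_def counter_step_def map_pmf_comp pmf_map measure_pmf_of_set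
        finite_counter_pairs card_counter_pairs)
  also have "real (card (counter_pairs \<inter> (\<lambda>S. gaps (update (config_of_gaps g) S)) -` {h})) =
     (\<Sum>S\<in>counter_pairs. if gaps (update (config_of_gaps g) S) = h then 1 else 0)"
    by (simp add: sum.If_cases finite_counter_pairs vimage_def)
  finally show ?thesis .
qed

lemmas gap_simps = sum_counter_pairs gaps_def levels_eq update_def updated_pair
  config_of_gaps_def

lemma gaps_update_00:
  shows
    "gaps (update (config_of_gaps (0, 0)) {0, 1}) = (1, 0)"
    "gaps (update (config_of_gaps (0, 0)) {0, 2}) = (1, 0)"
    "gaps (update (config_of_gaps (0, 0)) {0, 3}) = (1, 0)"
    "gaps (update (config_of_gaps (0, 0)) {1, 2}) = (1, 0)"
    "gaps (update (config_of_gaps (0, 0)) {1, 3}) = (1, 0)"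
    "gaps (update (config_of_gaps (0, 0)) {2, 3}) = (1, 0)"
  by (simp_all add: gap_simps nat_diff_distrib')

lemma gaps_update_k0:
  assumes "k \<ge> 1"
  shows
    "gaps (update (config_of_gaps (k, 0)) {0, 1}) = (k + 1, 0)"
    "gaps (update (config_of_gaps (k, 0)) {0, 2}) = (k - 1, 1)"
    "gaps (update (config_of_gaps (k, 0)) {0, 3}) = (k - 1, 1)"
    "gaps (update (config_of_gaps (k, 0)) {1, 2}) = (k - 1, 1)"
    "gaps (update (config_of_gaps (k, 0)) {1, 3}) = (k - 1, 1)"
    "gaps (update (config_of_gaps (k, 0)) {2, 3}) = (k - 1, 0)"
  using assms by (simp_all add: gap_simps nat_diff_distrib')

lemma gaps_update_0l:
  assumes "l \<ge> 1"
  shows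
    "gaps (update (config_of_gaps (0, l)) {0, 1}) = (1, l)"
    "gaps (update (config_of_gaps (0, l)) {0, 2}) = (1, l)"
    "gaps (update (config_of_gaps (0, l)) {0, 3}) = (0, l - 1)"
    "gaps (update (config_of_gaps (0, l)) {1, 2}) = (1, l)"
    "gaps (update (config_of_gaps (0, l)) {1, 3}) = (0, l - 1)"
    "gaps (update (config_of_gaps (0, l)) {2, 3}) = (0, l - 1)"
  using assms by (simp_all add: gap_simps nat_diff_distrib')

lemma gaps_update_kl:
  assumes "k \<ge> 1" and "l \<ge> 1"
  shows
    "gaps (update (config_of_gaps (k, l)) {0, 1}) = (k + 1, l)"
    "gaps (update (config_of_gaps (k, l)) {0, 2}) = (k - 1, l + 1)"
    "gaps (update (config_of_gaps (k, l)) {0, 3}) = (k, l - 1)"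
    "gaps (update (config_of_gaps (k, l)) {1, 2}) = (k - 1, l + 1)"
    "gaps (update (config_of_gaps (k, l)) {1, 3}) = (k, l - 1)"
    "gaps (update (config_of_gaps (k, l)) {2, 3}) = (k, l - 1)"
  using assms by (simp_all add: gap_simps) (linarith | force)+

lemma gap_kernel_transitions:
  "pmf (gap_kernel (0, 0)) (1, 0) = 1"
  "k \<ge> 1 \<Longrightarrow> pmf (gap_kernel (k, 0)) (k + 1, 0) = 1/6"
  "k \<ge> 1 \<Longrightarrow> pmf (gap_kernel (k, 0)) (k - 1, 0) = 1/6"
  "k \<ge> 1 \<Longrightarrow> pmf (gap_kernel (k, 0)) (k - 1, 1) = 2/3"
  "l \<ge> 1 \<Longrightarrow> pmf (gap_kernel (0, l)) (0, l - 1) = 1/2"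
  "l \<ge> 1 \<Longrightarrow> pmf (gap_kernel (0, l)) (1, l) = 1/2"
  "k \<ge> 1 \<Longrightarrow> l \<ge> 1 \<Longrightarrow> pmf (gap_kernel (k, l)) (k + 1, l) = 1/6"
  "k \<ge> 1 \<Longrightarrow> l \<ge> 1 \<Longrightarrow> pmf (gap_kernel (k, l)) (k, l - 1) = 1/2"
  "k \<ge> 1 \<Longrightarrow> l \<ge> 1 \<Longrightarrow> pmf (gap_kernel (k, l)) (k - 1, l + 1) = 1/3"
  by (simp_all add: pmf_gap_kernel sum_counter_pairs gaps_update_00 gaps_update_k0 gaps_update_0l
      gaps_update_kl del: One_nat_def)

lemma mean_updates_eq:
  "mean_updates x = (\<Sum>S\<in>counter_pairs. real (card (updated x S))) / 6"
  by (simp add: mean_updates_def integral_pmf_of_set finite_counter_pairs card_counter_pairs)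

lemma mean_updates_config_of_gaps:
  "mean_updates (config_of_gaps (k, l)) =
     (if k = 0 \<and> l = 0 then 2 else if l = 0 then 4/3 else if k = 0 then 3/2 else 7/6)"
  by (simp add: mean_updates_eq gap_simps)

lemma levels_cong: "(\<And>i. i < 4 \<Longrightarrow> x i = y i) \<Longrightarrow> levels x = levels y"
  by (auto simp: levels_def intro!: arg_cong[of _ _ sort])

lemma updated_cong:
  "S \<subseteq> counters \<Longrightarrow> (\<And>i. i < 4 \<Longrightarrow> x i = y i) \<Longrightarrow> updated x S = updated y S"
  unfolding updated_def counters_def by (rule Collect_cong) (metis lessThan_iff subsetD)

lemma gaps_update_cong:
  assumes "S \<subseteq> counters" "\<And>i. i < 4 \<Longrightarrow> x i = y i"
  shows "gaps (update x S) = gaps (update y S)"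
proof -
  have "levels (update x S) = levels (update y S)"
    by (rule levels_cong) (use assms updated_cong[OF assms] in \<open>simp add: update_def\<close>)
  then show ?thesis
    by (simp add: gaps_def)
qed

lemma updated_shift: "updated (\<lambda>i. x i + c) S = updated x S"
  by (simp add: updated_def)

lemma levels_shift: "levels (\<lambda>i. x i + c) = map (\<lambda>v. v + c) (levels x)"
  unfolding levels_def by (rule properties_for_sort) (simp_all add: sorted_map o_def multiset.map_comp)

lemma gaps_update_shift: "gaps (update (\<lambda>i. x i + c) S) = gaps (update x S)"
proof -
  have "update (\<lambda>i. x i + c) S = (\<lambda>i. update x S i + c)"
    by (auto simp: update_def updated_shift)
  moreover have "length (levels y) = 4" for y
    by (simp add: levels_def)
  ultimately show ?thesis
    by (simp add: gaps_def levels_shift)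
qed

context
  fixes p :: "nat \<Rightarrow> nat"
  assumes p: "bij_betw p counters counters"
begin

lemma levels_perm: "levels (x \<circ> p) = levels x"
proof -
  have mset_up: "mset [0..<4] = mset_set counters"
    by (simp add: counters_def lessThan_atLeast0)
  have "mset (map (x \<circ> p) [0..<4]) = image_mset x (image_mset p (mset_set counters))"
    by (simp only: mset_map mset_up image_mset.comp o_def multiset.map_comp)
  also have "image_mset p (mset_set counters) = mset_set counters"
    using p by (simp add: image_mset_mset_set bij_betw_def)
  also have "image_mset x (mset_set counters) = mset (map x [0..<4])"
    by (simp only: mset_map mset_up)
  finally have "mset (map (x \<circ> p) [0..<4]) = mset (map x [0..<4])" .
  then show ?thesis
    unfolding levels_def by (metis mset_sort properties_for_sort sorted_sort)
qed

lemma updated_perm: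
  assumes "S \<subseteq> counters"
  shows "updated x (p ` S) = p ` updated (x \<circ> p) S"
  by (auto simp: updated_def)

lemma gaps_update_perm:
  assumes S: "S \<subseteq> counters"
  shows "gaps (update (x \<circ> p) S) = gaps (update x (p ` S))"
proof -
  have inj: "inj_on p counters"
    using p by (simp add: bij_betw_def)
  have "p i \<in> p ` updated (x \<circ> p) S \<longleftrightarrow> i \<in> updated (x \<circ> p) S" if "i < 4" for i
    by (rule inj_on_image_mem_iff[OF inj])
       (use that S in \<open>auto simp: counters_def updated_def\<close>)
  then have "levels (update (x \<circ> p) S) = levels (update x (p ` S) \<circ> p)"
    by (intro levels_cong) (simp add: update_def updated_perm[OF S])
  then show ?thesis
    by (simp add: gaps_def levels_perm)
qed

lemma bij_betw_counter_pairs: "bij_betw ((`) p) counter_pairs counter_pairs"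
proof -
  have inj: "inj_on p counters" and im: "p ` counters = counters"
    using p by (simp_all add: bij_betw_def)
  have inj': "inj_on ((`) p) counter_pairs"
    by (rule inj_on_subset[OF inj_on_image_Pow[OF inj]]) (auto simp: counter_pairs_def)
  have "(`) p ` counter_pairs \<subseteq> counter_pairs"
  proof
    fix T assume "T \<in> (`) p ` counter_pairs"
    then obtain S where S: "T = p ` S" "S \<subseteq> counters" "card S = 2"
      by (auto simp: counter_pairs_def)
    moreover have "card (p ` S) = card S"
      using inj S by (meson card_image inj_on_subset)
    ultimately show "T \<in> counter_pairs"
      using im by (auto simp: counter_pairs_def)
  qed
  then show ?thesis
    using inj' finite_counter_pairs by (simp add: bij_betw_def endo_inj_surj)
qed

lemma gaps_counter_step_perm:
  "map_pmf gaps (counter_step (x \<circ> p)) = map_pmf gaps (counter_step x)"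
proof -
  have "map_pmf gaps (counter_step (x \<circ> p)) =
      map_pmf (\<lambda>S. gaps (update x (p ` S))) (pmf_of_set counter_pairs)"
    unfolding counter_step_def map_pmf_comp
    by (rule map_pmf_cong[OF refl], rule gaps_update_perm)
       (simp add: finite_counter_pairs, simp add: counter_pairs_def)
  also have "\<dots> = map_pmf (\<lambda>S. gaps (update x S)) (map_pmf ((`) p) (pmf_of_set counter_pairs))"
    by (simp add: map_pmf_comp)
  also have "map_pmf ((`) p) (pmf_of_set counter_pairs) = pmf_of_set counter_pairs"
    by (rule map_pmf_of_set_bij_betw[OF bij_betw_counter_pairs])
       (simp_all add: finite_counter_pairs)
  finally show ?thesis
    unfolding counter_step_def map_pmf_comp .
qed

lemma mean_updates_perm: "mean_updates (x \<circ> p) = mean_updates x"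
proof -
  have "(\<Sum>S\<in>counter_pairs. real (card (updated (x \<circ> p) S))) =
      (\<Sum>S\<in>counter_pairs. real (card (updated x (p ` S))))"
  proof (rule sum.cong[OF refl])
    fix S assume "S \<in> counter_pairs"
    then have S: "S \<subseteq> counters"
      by (simp add: counter_pairs_def)
    have "inj_on p (updated (x \<circ> p) S)"
      by (rule inj_on_subset[OF bij_betw_imp_inj_on[OF p]])
         (use S in \<open>auto simp: updated_def\<close>)
    then show "real (card (updated (x \<circ> p) S)) = real (card (updated x (p ` S)))"
      by (simp add: updated_perm[OF S] card_image)
  qed
  also have "\<dots> = (\<Sum>S\<in>counter_pairs. real (card (updated x S)))"
    by (rule sum.reindex_bij_betw[OF bij_betw_counter_pairs])
  finally show ?thesis
    by (simp add: mean_updates_eq)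
qed

end

lemma representative:
  assumes "two_at_top x"
  obtains p c where "bij_betw p counters counters"
    "\<And>i. i < 4 \<Longrightarrow> (x \<circ> p) i = config_of_gaps (gaps x) i + c"
proof -
  define js where "js = rev (sort_key x [0..<4])"
  define p where "p i = js ! i" for i
  have len: "length js = 4" and "distinct js" "set js = counters"
    by (auto simp: js_def counters_def lessThan_atLeast0)
  then have p: "bij_betw p counters counters"
    unfolding p_def counters_def by (intro bij_betw_nth) auto
  have lev: "levels x = map x (rev js)"
    unfolding levels_def js_def by (rule properties_for_sort) (simp_all add: sorted_sort_key)
  have nth: "levels x ! i = x (p (3 - i))" if "i < 4" for i
    using that len by (simp add: lev p_def rev_nth)
  have sorted: "sorted (levels x)" "length (levels x) = 4"
    by (simp_all add: levels_def)
  then have le: "levels x ! 0 \<le> levels x ! 1" "levels x ! 1 \<le> levels x ! 2"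
    by (auto intro!: sorted_nth_mono)
  have top: "levels x ! 2 = levels x ! 3"
    using assms by (simp add: two_at_top_def)
  have "(x \<circ> p) i = config_of_gaps (gaps x) i + levels x ! 0" if "i < 4" for i
  proof -
    from that have "i = 0 \<or> i = 1 \<or> i = 2 \<or> i = 3"
      by auto
    then show ?thesis
      using le top nth[of 0] nth[of 1] nth[of 2] nth[of 3]
      by (elim disjE) (simp_all add: config_of_gaps_def gaps_def)
  qed
  with p show ?thesis
    by (rule that)
qed

theorem gap_kernel_counter_step:
  assumes "two_at_top x"
  shows "map_pmf gaps (counter_step x) = gap_kernel (gaps x)"
proof -
  from representative[OF assms] obtain p c where
    p: "bij_betw p counters counters" and
    c: "\<And>i. i < 4 \<Longrightarrow> (x \<circ> p) i = config_of_gaps (gaps x) i + c"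
    by blast
  have "map_pmf gaps (counter_step x) = map_pmf gaps (counter_step (x \<circ> p))"
    by (simp add: gaps_counter_step_perm[OF p])
  also have "\<dots> = gap_kernel (gaps x)"
    unfolding gap_kernel_def counter_step_def map_pmf_comp
  proof (rule map_pmf_cong[OF refl])
    fix S assume "S \<in> set_pmf (pmf_of_set counter_pairs)"
    then have "S \<subseteq> counters"
      by (simp add: finite_counter_pairs) (simp add: counter_pairs_def)
    then have "gaps (update (x \<circ> p) S) =
        gaps (update (\<lambda>i. config_of_gaps (gaps x) i + c) S)"
      by (rule gaps_update_cong) (rule c)
    then show "gaps (update (x \<circ> p) S) = gaps (update (config_of_gaps (gaps x)) S)"
      by (simp only: gaps_update_shift)
  qed
  finally show ?thesis .
qed

theorem mean_updates_representative:
  assumes "two_at_top x"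
  shows "mean_updates x = mean_updates (config_of_gaps (gaps x))"
proof -
  from representative[OF assms] obtain p c where
    p: "bij_betw p counters counters" and
    c: "\<And>i. i < 4 \<Longrightarrow> (x \<circ> p) i = config_of_gaps (gaps x) i + c"
    by blast
  have "updated (x \<circ> p) S = updated (config_of_gaps (gaps x)) S" if "S \<in> counter_pairs" for S
  proof -
    have "updated (x \<circ> p) S = updated (\<lambda>i. config_of_gaps (gaps x) i + c) S"
      by (rule updated_cong) (use that in \<open>simp add: counter_pairs_def\<close>, rule c)
    then show ?thesis
      by (simp only: updated_shift)
  qed
  then have "mean_updates (x \<circ> p) = mean_updates (config_of_gaps (gaps x))"
    by (simp add: mean_updates_eq)
  then show ?thesis
    by (simp add: mean_updates_perm[OF p])
qed

theorem V4_eq: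
  "V4 = 1 + measure gap_stationary {(0, 0)}
     + 1/3 * measure gap_stationary {(k, 0) | k. k \<ge> 1}
     + 1/2 * measure gap_stationary {(0, l) | l. l \<ge> 1}
     + 1/6 * measure gap_stationary {(k, l) | k l. k \<ge> 1 \<and> l \<ge> 1}"
  (is "_ = 1 + measure _ ?A + 1/3 * measure _ ?B + 1/2 * measure _ ?C + 1/6 * measure _ ?D")
proof -
  have "mean_updates (config_of_gaps g) =
      1 + indicator ?A g + 1/3 * indicator ?B g + 1/2 * indicator ?C g + 1/6 * indicator ?D g" for g
    by (cases g) (auto simp: mean_updates_config_of_gaps indicator_def)
  then show ?thesis
    unfolding V4_def by (simp add: measure_pmf.emeasure_eq_measure)
qed

end

theory Submission
  imports Defs
begin

section \<open>Stationary distributions of Markov kernels\<close>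

text \<open>Split the state space into the origin, the two axes without it, and the interior. The
  mean increments of both gaps are constant on each of these four sets (\<open>fst_drift\<close>,
  \<open>snd_drift\<close>), and under the stationary law each mean increment averages to zero
  (\<open>stationary_drift_zero\<close>). With total mass 1 this gives three linear equations for
  the four masses (\<open>gap_stationary_balance\<close>). The speed is linear in the same masses,
  so one free parameter remains, and nonnegativity of the masses confines the speed to the stated
  interval.

  Since \<open>gap_stationary\<close> is a definite description, it must also be shown that exactly
  one stationary law exists. Existence comes from a Lyapunov function bounding the mean return time
  to the origin (\<open>stationary_exists\<close>, \<open>lyap_drift\<close>), uniqueness from the
  minimum of two stationary laws (\<open>stationary_unique\<close>).\<close>

definition push :: "('a \<Rightarrow> 'a pmf) \<Rightarrow> ('a \<Rightarrow> ennreal) \<Rightarrow> 'a \<Rightarrow> ennreal" where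
  "push K f y = (\<integral>\<^sup>+x. f x * pmf (K x) y \<partial>count_space UNIV)"

text \<open>Tonelli: \<open>push\<close> on measures is dual to averaging functions over one step.
  Values in \<open>ennreal\<close> let unnormalised measures be handled before their mass is known
  to be finite.\<close>

lemma nn_integral_push:
  "(\<integral>\<^sup>+y. push K f y * g y \<partial>count_space UNIV) =
     (\<integral>\<^sup>+x. f x * (\<integral>\<^sup>+y. g y \<partial>K x) \<partial>count_space UNIV)"
proof -
  have "(\<integral>\<^sup>+y. push K f y * g y \<partial>count_space UNIV) =
      (\<integral>\<^sup>+y. \<integral>\<^sup>+x. (\<lambda>(x, y). f x * pmf (K x) y * g y) (x, y) \<partial>count_space UNIV \<partial>count_space UNIV)"
    by (simp add: push_def nn_integral_multc)
  also have "\<dots> =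
      (\<integral>\<^sup>+x. \<integral>\<^sup>+y. (\<lambda>(x, y). f x * pmf (K x) y * g y) (x, y) \<partial>count_space UNIV \<partial>count_space UNIV)"
    by (simp only: nn_integral_fst_count_space nn_integral_snd_count_space)
  also have "\<dots> = (\<integral>\<^sup>+x. f x * (\<integral>\<^sup>+y. g y \<partial>K x) \<partial>count_space UNIV)"
    by (simp add: nn_integral_measure_pmf nn_integral_cmult[symmetric] mult.assoc)
  finally show ?thesis .
qed

lemma nn_integral_push_1:
  "(\<integral>\<^sup>+y. push K f y \<partial>count_space UNIV) = (\<integral>\<^sup>+x. f x \<partial>count_space UNIV)"
  using nn_integral_push[of K f "\<lambda>_. 1"] by (simp add: measure_pmf.emeasure_space_1)

lemma push_add: "push K (\<lambda>x. f x + g x) y = push K f y + push K g y"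
  by (simp add: push_def distrib_right nn_integral_add)

lemma push_mono: "(\<And>x. f x \<le> g x) \<Longrightarrow> push K f y \<le> push K g y"
  unfolding push_def by (intro nn_integral_mono mult_right_mono) auto

lemma is_stationary_iff_push:
  "is_stationary K \<mu> \<longleftrightarrow> (\<forall>y. push K (\<lambda>x. ennreal (pmf \<mu> x)) y = pmf \<mu> y)"
proof -
  have "ennreal (pmf (bind_pmf \<mu> K) y) = push K (\<lambda>x. ennreal (pmf \<mu> x)) y" for y
    unfolding ennreal_pmf_bind nn_integral_measure_pmf push_def ..
  then show ?thesis
    unfolding is_stationary_def pmf_eq_iff
    by (metis ennreal_inj pmf_nonneg)
qed

text \<open>Upgrades pointwise inequalities such as subinvariance to equality, because
  \<open>push\<close> preserves mass.\<close>

lemma nn_integral_count_space_eq_imp_eq: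
  fixes f g :: "'a \<Rightarrow> ennreal"
  assumes le: "\<And>x. f x \<le> g x"
    and eq: "(\<integral>\<^sup>+x. f x \<partial>count_space UNIV) = (\<integral>\<^sup>+x. g x \<partial>count_space UNIV)"
    and fin: "(\<integral>\<^sup>+x. g x \<partial>count_space UNIV) < \<infinity>"
  shows "f x = g x"
proof -
  have "(\<integral>\<^sup>+x. g x - f x \<partial>count_space UNIV) = 0"
    using le eq fin by (subst nn_integral_diff) auto
  then have "g x - f x = 0"
    by (simp add: nn_integral_0_iff_AE AE_count_space)
  then show ?thesis
    using le[of x] by (simp add: diff_eq_0_iff_ennreal dual_order.antisym)
qed

section \<open>Existence of a stationary distribution\<close>

text \<open>The stationary distribution is the normalised expected number of visits during an excursion
  from \<open>z\<close>; \<open>h\<close> bounds the mean length of the excursion.\<close>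

lemma stationary_exists:
  fixes K :: "'a \<Rightarrow> 'a pmf" and h :: "'a \<Rightarrow> ennreal"
  assumes drift: "\<And>x. (\<integral>\<^sup>+y. h y * indicator (-{z}) y \<partial>K x) + 1 \<le> h x"
    and fin: "h z < \<infinity>"
  shows "\<exists>\<mu>. is_stationary K \<mu>"
proof -
  \<comment> \<open>\<open>a n y\<close> is the probability that the chain started at
    \<open>z\<close> is at \<open>y\<close> at time \<open>n\<close> without having returned to
    \<open>z\<close>.\<close>
  define a :: "nat \<Rightarrow> 'a \<Rightarrow> ennreal" where
    "a = rec_nat (indicator {z}) (\<lambda>_ f y. push K f y * indicator (-{z}) y)"
  have a_0: "a 0 = indicator {z}"
    and a_Suc: "a (Suc n) y = push K (a n) y * indicator (-{z}) y" for n y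
    by (simp_all add: a_def)
  define I where "I n f = (\<integral>\<^sup>+x. a n x * f x \<partial>count_space UNIV)" for n f
  have I_Suc: "I (Suc n) f = I n (\<lambda>x. \<integral>\<^sup>+y. f y * indicator (-{z}) y \<partial>K x)" for n f
  proof -
    have "I (Suc n) f = (\<integral>\<^sup>+y. push K (a n) y * (f y * indicator (-{z}) y) \<partial>count_space UNIV)"
      by (simp add: I_def a_Suc mult_ac)
    then show ?thesis
      by (simp add: nn_integral_push I_def)
  qed
  have descent: "I (Suc n) h + I n (\<lambda>_. 1) \<le> I n h" for n
  proof -
    have "I (Suc n) h + I n (\<lambda>_. 1) =
        I n (\<lambda>x. (\<integral>\<^sup>+y. h y * indicator (-{z}) y \<partial>K x) + 1)"
      unfolding I_Suc by (simp add: I_def nn_integral_add[symmetric] distrib_left)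
    also have "\<dots> \<le> I n h"
      unfolding I_def by (intro nn_integral_mono mult_left_mono drift) auto
    finally show ?thesis .
  qed
  \<comment> \<open>\<open>descent\<close> telescopes; dropping \<open>I N h\<close> bounds the mean
    excursion length by \<open>h z\<close>.\<close>
  have "(\<Sum>n<N. I n (\<lambda>_. 1)) + I N h \<le> I 0 h" for N
  proof (induction N)
    case (Suc N)
    have "(\<Sum>n<Suc N. I n (\<lambda>_. 1)) + I (Suc N) h = (\<Sum>n<N. I n (\<lambda>_. 1)) + (I (Suc N) h + I N (\<lambda>_. 1))"
      by (simp add: ac_simps)
    also have "\<dots> \<le> (\<Sum>n<N. I n (\<lambda>_. 1)) + I N h"
      by (intro add_left_mono descent)
    finally show ?case
      using Suc.IH by (rule order_trans)
  qed simp
  moreover have "I 0 h = h z"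
    by (simp add: I_def a_0 mult.commute[of "indicator _ _"] nn_integral_indicator_singleton)
  ultimately have partial: "(\<Sum>n<N. I n (\<lambda>_. 1)) \<le> h z" for N
    by (metis add.right_neutral add_left_mono order_trans zero_le)
  define G where "G y = (\<Sum>n. a n y)" for y
  define M where "M = (\<integral>\<^sup>+y. G y \<partial>count_space UNIV)"
  have "M = (\<Sum>n. I n (\<lambda>_. 1))"
    by (simp add: M_def G_def I_def nn_integral_suminf)
  also have "\<dots> \<le> h z"
    by (intro suminf_le_const partial) simp
  finally have M_fin: "M < \<infinity>"
    using fin by (simp add: le_less_trans)
  have G_z: "G z = 1"
  proof -
    have "(\<lambda>n. a (Suc n) z) = (\<lambda>_. 0)"
      by (simp add: a_Suc fun_eq_iff)
    then show ?thesis
      unfolding G_def by (subst suminf_offset[where i = 1]) (simp_all add: a_0)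
  qed
  have push_G: "push K G y = (\<Sum>n. push K (a n) y)" for y
    unfolding push_def G_def by (simp add: nn_integral_suminf[symmetric] ennreal_suminf_multc)
  have off_z: "G y = push K G y" if "y \<noteq> z" for y
  proof -
    have "G y = (\<Sum>n. a (Suc n) y) + a 0 y"
      unfolding G_def by (subst suminf_offset[where i = 1]) simp_all
    then show ?thesis
      using that by (simp add: a_0 a_Suc push_G)
  qed
  \<comment> \<open>Off \<open>z\<close> invariance is built into the recursion. At \<open>z\<close>
    it follows by comparing total masses, which \<open>push\<close> preserves; the mass
    \<open>R\<close> off \<open>z\<close> is finite and cancels.\<close>
  have at_z: "push K G z = G z"
  proof -
    have split: "(\<integral>\<^sup>+y. f y \<partial>count_space UNIV) =
        f z + (\<integral>\<^sup>+y. f y * indicator (-{z}) y \<partial>count_space UNIV)" for f :: "'a \<Rightarrow> ennreal"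
    proof -
      have "(\<integral>\<^sup>+y. f y \<partial>count_space UNIV) =
          (\<integral>\<^sup>+y. f y * indicator {z} y + f y * indicator (-{z}) y \<partial>count_space UNIV)"
        by (intro nn_integral_cong) (simp add: indicator_def)
      then show ?thesis
        by (simp add: nn_integral_add nn_integral_indicator_singleton)
    qed
    define R where "R = (\<integral>\<^sup>+y. G y * indicator (-{z}) y \<partial>count_space UNIV)"
    have "R = (\<integral>\<^sup>+y. push K G y * indicator (-{z}) y \<partial>count_space UNIV)"
      unfolding R_def by (intro nn_integral_cong) (auto simp: indicator_def off_z)
    then have "M = push K G z + R"
      using split[of "push K G"] by (simp add: M_def nn_integral_push_1)
    moreover have "M = G z + R"
      using split[of G] by (simp add: M_def R_def)
    moreover have "R < \<infinity>"
      using M_fin \<open>M = G z + R\<close> by (auto simp: less_top)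
    ultimately show ?thesis
      by (metis add.commute ennreal_add_left_cancel infinity_ennreal_def order_less_irrefl)
  qed
  have inv: "push K G = G"
    using at_z off_z by (metis ext)
  have "M > 0"
    using G_z nn_integral_ge_point[of z UNIV G] by (simp add: M_def less_le_trans[of 0 1])
  define \<mu> where "\<mu> = embed_pmf (\<lambda>y. enn2real (G y / M))"
  have G_div_fin: "ennreal (enn2real (G y / M)) = G y / M" for y
  proof -
    have "G y \<le> M"
      using nn_integral_ge_point[of y UNIV G] by (simp add: M_def)
    then have "G y / M < \<infinity>"
      using M_fin \<open>M > 0\<close> by (auto simp: ennreal_divide_eq_top_iff less_top[symmetric] top_unique)
    then show ?thesis
      by (simp add: less_top)
  qed
  have "(\<integral>\<^sup>+y. G y / M \<partial>count_space UNIV) = 1"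
    using M_fin \<open>M > 0\<close> by (simp add: nn_integral_divide M_def[symmetric] ennreal_divide_self)
  then have \<mu>: "ennreal (pmf \<mu> y) = G y / M" for y
    unfolding \<mu>_def by (subst pmf_embed_pmf) (simp_all add: G_div_fin)
  have "push K (\<lambda>x. G x / M) y = push K G y / M" for y
    by (simp add: push_def nn_integral_cmult divide_ennreal_def mult_ac)
  then have "is_stationary K \<mu>"
    unfolding is_stationary_iff_push \<mu> by (simp add: inv)
  then show ?thesis ..
qed

section \<open>Uniqueness of the stationary distribution\<close>

lemma push_eq_self_vanishes:
  assumes inv: "\<And>y. push K f y = f y"
    and z: "f z = 0" and reach: "(x, z) \<in> {(x, y). y \<in> set_pmf (K x)}\<^sup>*"
  shows "f x = 0"
  using reach
proof (induction rule: converse_rtrancl_induct)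
  case (step x y)
  have "push K f y = 0"
    using inv step by simp
  \<comment> \<open>This is one nonnegative summand of the vanishing sum \<open>push K f y\<close>,
    so zeros propagate backwards along transitions.\<close>
  then have "f x * pmf (K x) y = 0"
    by (simp add: push_def nn_integral_0_iff_AE AE_count_space)
  then show ?case
    using step by (auto simp: set_pmf_iff)
qed (fact z)

text \<open>The minimum \<open>m\<close> of the two laws is subinvariant, hence invariant by
  conservation of mass, and so is the excess \<open>e\<close> of \<mu> over \<open>m\<close>. If
  \<mu> is the smaller law at \<open>z\<close>, then \<open>e\<close> vanishes there and thus
  everywhere, so \<mu> lies below \<nu>; equal masses force equality.\<close>

lemma stationary_unique:
  fixes K :: "'a \<Rightarrow> 'a pmf"
  assumes \<mu>: "is_stationary K \<mu>" and \<nu>: "is_stationary K \<nu>"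
    and reach: "\<And>x. (x, z) \<in> {(x, y). y \<in> set_pmf (K x)}\<^sup>*"
  shows "\<mu> = \<nu>"
  using \<mu> \<nu>
proof (induction "pmf \<mu> z" "pmf \<nu> z" arbitrary: \<mu> \<nu> rule: linorder_wlog)
  case sym
  then show ?case by metis
next
  case (le \<mu> \<nu>)
  define m e :: "'a \<Rightarrow> ennreal" where "m x = min (pmf \<mu> x) (pmf \<nu> x)"
    and "e x = pmf \<mu> x - m x" for x
  have mass: "(\<integral>\<^sup>+x. ennreal (pmf \<rho> x) \<partial>count_space UNIV) = 1" for \<rho> :: "'a pmf"
    using nn_integral_measure_pmf[of \<rho> "\<lambda>_. 1"] by (simp add: measure_pmf.emeasure_space_1)
  have m_le: "m x \<le> pmf \<mu> x" "m x \<le> pmf \<nu> x" for x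
    by (simp_all add: m_def)
  have m_mass: "(\<integral>\<^sup>+x. m x \<partial>count_space UNIV) < \<infinity>"
    using nn_integral_mono[of "count_space UNIV" m "\<lambda>x. pmf \<mu> x"] m_le(1) mass[of \<mu>]
    by (simp add: le_less_trans)
  have "push K m y \<le> m y" for y
  proof -
    have "push K m y \<le> pmf \<mu> y" "push K m y \<le> pmf \<nu> y"
      using push_mono[of m _ K y] m_le le.prems unfolding is_stationary_iff_push by metis+
    then show ?thesis
      by (cases "pmf \<mu> y \<le> pmf \<nu> y") (simp_all add: m_def min_absorb1 min_absorb2)
  qed
  then have m_inv: "push K m y = m y" for y
    using nn_integral_push_1 m_mass by (rule nn_integral_count_space_eq_imp_eq)
  have e_m: "pmf \<mu> x = e x + m x" for x
    by (simp add: e_def m_le diff_add_cancel_ennreal)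
  have e_inv: "push K e y = e y" for y
  proof -
    have "push K e y + m y = push K (\<lambda>x. e x + m x) y"
      by (simp add: push_add m_inv)
    also have "\<dots> = e y + m y"
      using le.prems(1) by (simp add: is_stationary_iff_push e_m[symmetric])
    finally show ?thesis
      using m_le(1)[of y] by (metis add.commute ennreal_add_left_cancel ennreal_less_top
          infinity_ennreal_def leD)
  qed
  have "m z = pmf \<mu> z"
    using le.hyps by (simp add: m_def ennreal_leI)
  then have "e z = 0"
    by (simp add: e_def)
  then have "e x = 0" for x
    using push_eq_self_vanishes[OF e_inv _ reach] by blast
  then have "ennreal (pmf \<mu> x) \<le> pmf \<nu> x" for x
    using e_m[of x] m_le(2)[of x] by simp
  then have "ennreal (pmf \<mu> x) = pmf \<nu> x" for x
    by (rule nn_integral_count_space_eq_imp_eq) (simp_all add: mass)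
  then show ?case
    by (intro pmf_eqI) simp
qed

section \<open>Zero mean drift under stationarity\<close>

text \<open>Truncating \<open>f\<close> makes the identity trivial, and dominated convergence removes the truncation:
  \<open>f\<close> itself need not be integrable.\<close>

lemma stationary_drift_zero:
  fixes K :: "'a \<Rightarrow> 'a pmf" and f :: "'a \<Rightarrow> real"
  assumes stat: "is_stationary K \<mu>"
    and nonneg: "\<And>x. 0 \<le> f x"
    and bdd: "\<And>x y. y \<in> set_pmf (K x) \<Longrightarrow> \<bar>f y - f x\<bar> \<le> c"
  shows "(\<integral>x. (\<integral>y. f y - f x \<partial>K x) \<partial>\<mu>) = 0"
proof -
  \<comment> \<open>The joint law of two consecutive states; stationarity makes both marginals
    \<mu>.\<close>
  define J where "J = bind_pmf \<mu> (\<lambda>x. map_pmf (Pair x) (K x))"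
  have fst_J: "map_pmf fst J = \<mu>" and snd_J: "map_pmf snd J = \<mu>"
    using stat by (simp_all add: J_def map_bind_pmf map_pmf_comp is_stationary_def bind_return_pmf')
  have J_bdd: "AE p in J. \<bar>f (snd p) - f (fst p)\<bar> \<le> c"
    by (auto simp: AE_measure_pmf_iff J_def bdd)
  have int0: "(\<integral>p. min (f (snd p)) (real n) - min (f (fst p)) (real n) \<partial>J) = 0" for n
  proof -
    let ?t = "\<lambda>x. min (f x) (real n)"
    have int: "integrable (measure_pmf J) (\<lambda>p. ?t (g p))" for g :: "'a \<times> 'a \<Rightarrow> 'a"
      using nonneg by (intro measure_pmf.integrable_const_bound[where B = "real n"]) auto
    have "(\<integral>p. ?t (snd p) - ?t (fst p) \<partial>J) =
        (\<integral>p. ?t (snd p) \<partial>J) - (\<integral>p. ?t (fst p) \<partial>J)"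
      by (intro Bochner_Integration.integral_diff int)
    also have "\<dots> = (\<integral>x. ?t x \<partial>map_pmf snd J) - (\<integral>x. ?t x \<partial>map_pmf fst J)"
      by simp
    finally show ?thesis
      by (simp only: fst_J snd_J diff_self)
  qed
  have "(\<lambda>n. \<integral>p. min (f (snd p)) (real n) - min (f (fst p)) (real n) \<partial>J)
      \<longlonglongrightarrow> (\<integral>p. f (snd p) - f (fst p) \<partial>J)"
  proof (rule integral_dominated_convergence[where w = "\<lambda>_. c"])
    have lim: "(\<lambda>n. min r (real n)) \<longlonglongrightarrow> r" for r
    proof (rule tendsto_eventually)
      obtain N where "r \<le> real N"
        using real_arch_simple by blast
      then show "\<forall>\<^sub>F n in sequentially. min r (real n) = r"
        unfolding eventually_sequentially by (intro exI[of _ N]) (auto simp: min_def)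
    qed
    show "AE p in J. (\<lambda>n. min (f (snd p)) (real n) - min (f (fst p)) (real n))
        \<longlonglongrightarrow> f (snd p) - f (fst p)"
      by (intro AE_I2 tendsto_diff lim)
    show "AE p in J. norm (min (f (snd p)) (real n) - min (f (fst p)) (real n)) \<le> c" for n
      using J_bdd by eventually_elim auto
  qed auto
  then have "(\<integral>p. f (snd p) - f (fst p) \<partial>J) = 0"
    by (simp add: int0 LIMSEQ_const_iff)
  \<comment> \<open>\<open>integral_bind\<close> needs a bounded integrand, but the increment is
    bounded only almost surely under \<open>J\<close>; \<open>g\<close> sets it to 0
    elsewhere.\<close>
  moreover define g where "g p = (if \<bar>f (snd p) - f (fst p)\<bar> \<le> c then f (snd p) - f (fst p) else 0)" for p
  have "(\<integral>p. f (snd p) - f (fst p) \<partial>J) = (\<integral>p. g p \<partial>J)"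
    using J_bdd by (intro integral_cong_AE) (auto simp: g_def)
  also have "\<dots> = (\<integral>x. (\<integral>p. g p \<partial>map_pmf (Pair x) (K x)) \<partial>\<mu>)"
    unfolding J_def measure_pmf_bind
    by (rule integral_bind[where B = "\<bar>c\<bar>" and K = "count_space UNIV" and B' = 1])
       (auto simp: g_def measure_pmf.emeasure_space_1 measure_pmf.finite_measure_axioms
         intro!: measure_pmf_in_subprob_algebra)
  also have "\<dots> = (\<integral>x. (\<integral>y. f y - f x \<partial>K x) \<partial>\<mu>)"
    by (intro Bochner_Integration.integral_cong refl, simp, intro integral_cong_AE)
       (auto simp: g_def AE_measure_pmf_iff bdd)
  ultimately show ?thesis
    by simp
qed

section \<open>The gap process\<close>

lemma gap_kernel_eq:
  "gap_kernel g = map_pmf (\<lambda>S. gaps (update (config_of_gaps g) S)) (pmf_of_set counter_pairs)"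
  by (simp add: gap_kernel_def counter_step_def map_pmf_comp)

lemma integral_gap_kernel:
  fixes f :: "nat \<times> nat \<Rightarrow> real"
  shows "(\<integral>y. f y \<partial>gap_kernel g) =
    (\<Sum>S\<in>counter_pairs. f (gaps (update (config_of_gaps g) S))) / 6"
  by (simp add: gap_kernel_eq integral_pmf_of_set finite_counter_pairs
      card_counter_pairs)

lemma nn_integral_gap_kernel:
  fixes f :: "nat \<times> nat \<Rightarrow> real"
  assumes "\<And>x. 0 \<le> f x"
  shows "(\<integral>\<^sup>+y. ennreal (f y) \<partial>gap_kernel g) =
    ennreal ((\<Sum>S\<in>counter_pairs. f (gaps (update (config_of_gaps g) S))) / 6)"
  using assms
  by (simp add: gap_kernel_eq nn_integral_pmf_of_set finite_counter_pairs
      card_counter_pairs sum_nonneg divide_ennreal[symmetric])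

lemma set_pmf_gap_kernel:
  "set_pmf (gap_kernel g) = (\<lambda>S. gaps (update (config_of_gaps g) S)) ` counter_pairs"
  by (simp add: gap_kernel_eq finite_counter_pairs)

lemma gap_cases:
  fixes g :: "nat \<times> nat"
  obtains (origin) "g = (0, 0)" | (right) k where "g = (k, 0)" "k \<ge> 1"
    | (up) l where "g = (0, l)" "l \<ge> 1" | (interior) k l where "g = (k, l)" "k \<ge> 1" "l \<ge> 1"
  by (cases g) (metis One_nat_def Suc_leI gr0I)

section \<open>The gap process has exactly one stationary distribution\<close>

text \<open>Both gaps together have drift \<open>-1/3\<close> in the interior but no drift on the axes; the bonus \<open>6\<close>
  for being on an axis makes the drift negative there too. The
  value \<open>67\<close> at the origin is one more than the value at its only successor \<open>(1, 0)\<close>.\<close>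

definition lyap :: "nat \<times> nat \<Rightarrow> real" where
  "lyap g = 60 * real (fst g + snd g) + (if fst g = 0 \<longleftrightarrow> snd g = 0 then 0 else 6)
     + (if g = (0, 0) then 67 else 0)"

text \<open>The bonus 6 is tight at \<open>(1, 0)\<close>: it is lost only by the move to the
  origin, of probability 1/6, so the expectation drops by exactly 1. In the interior the linear part
  drops by 20, while the expected bonus gained is at most 5.\<close>

lemma lyap_drift:
  "(\<Sum>S\<in>counter_pairs. (\<lambda>y. lyap y * indicator (-{(0, 0)}) y) (gaps (update (config_of_gaps g) S))) / 6 + 1
     \<le> lyap g"
proof (cases g rule: gap_cases)
  case origin
  then show ?thesis
    by (simp only: sum_counter_pairs gaps_update_00) (simp add: lyap_def indicator_def)
next
  case (right k)
  then show ?thesis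
    by (simp only: sum_counter_pairs gaps_update_k0)
       (auto simp: lyap_def indicator_def of_nat_diff)
next
  case (up l)
  then show ?thesis
    by (simp only: sum_counter_pairs gaps_update_0l)
       (auto simp: lyap_def indicator_def of_nat_diff)
next
  case (interior k l)
  then show ?thesis
    by (simp only: sum_counter_pairs gaps_update_kl)
       (auto simp: lyap_def indicator_def of_nat_diff add_divide_distrib diff_divide_distrib)
qed

lemma gap_stationary_exists: "\<exists>\<mu>. is_stationary gap_kernel \<mu>"
proof (rule stationary_exists[where h = "\<lambda>g. ennreal (lyap g)" and z = "(0, 0)"])
  fix x
  have nonneg: "0 \<le> lyap y" for y
    by (simp add: lyap_def)
  have "(\<integral>\<^sup>+y. ennreal (lyap y) * indicator (-{(0, 0)}) y \<partial>gap_kernel x) + 1 =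
      (\<integral>\<^sup>+y. ennreal (lyap y * indicator (-{(0, 0)}) y) \<partial>gap_kernel x) + 1"
    by (simp add: ennreal_mult'' ennreal_indicator)
  also have "\<dots> = ennreal ((\<Sum>S\<in>counter_pairs.
      (\<lambda>y. lyap y * indicator (-{(0, 0)}) y) (gaps (update (config_of_gaps x) S))) / 6 + 1)"
    using nonneg by (subst nn_integral_gap_kernel)
      (simp_all add: ennreal_plus[symmetric] sum_nonneg del: ennreal_plus flip: ennreal_1)
  also have "\<dots> \<le> ennreal (lyap x)"
    by (intro ennreal_leI lyap_drift)
  finally show "(\<integral>\<^sup>+y. ennreal (lyap y) * indicator (-{(0, 0)}) y \<partial>gap_kernel x) + 1
      \<le> ennreal (lyap x)" .
qed simp

text \<open>Away from the origin, some transition of positive probability lowers the total gap by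
  one.\<close>

lemma gap_kernel_reaches_origin: "(g, (0, 0)) \<in> {(x, y). y \<in> set_pmf (gap_kernel x)}\<^sup>*"
  (is "_ \<in> ?R\<^sup>*")
proof (induction "fst g + snd g" arbitrary: g rule: less_induct)
  case less
  have step: ?case if "(g, g') \<in> ?R" "fst g' + snd g' < fst g + snd g" for g'
    using less[OF that(2)] that(1) by (rule converse_rtrancl_into_rtrancl[rotated])
  show ?case
  proof (cases g rule: gap_cases)
    case (right k)
    then show ?thesis
      using gap_kernel_transitions(3)[of k] by (intro step[of "(k - 1, 0)"]) (auto simp: set_pmf_iff)
  next
    case (up l)
    then show ?thesis
      using gap_kernel_transitions(5)[of l] by (intro step[of "(0, l - 1)"]) (auto simp: set_pmf_iff)
  next
    case (interior k l)
    then show ?thesis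
      using gap_kernel_transitions(8)[of k l] by (intro step[of "(k, l - 1)"]) (auto simp: set_pmf_iff)
  qed simp
qed

lemma gap_stationary: "is_stationary gap_kernel gap_stationary"
  unfolding gap_stationary_def
proof (rule theI')
  show "\<exists>!\<mu>. is_stationary gap_kernel \<mu>"
    using gap_stationary_exists stationary_unique[OF _ _ gap_kernel_reaches_origin] by blast
qed

section \<open>Balance equations for the four masses\<close>

lemma gap_kernel_step_bounded:
  assumes "y \<in> set_pmf (gap_kernel x)"
  shows "\<bar>real (fst y) - real (fst x)\<bar> \<le> 1" "\<bar>real (snd y) - real (snd x)\<bar> \<le> 1"
proof -
  have "\<bar>real (fst y) - real (fst x)\<bar> \<le> 1 \<and> \<bar>real (snd y) - real (snd x)\<bar> \<le> 1"
  proof (cases x rule: gap_cases)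
    case origin
    then show ?thesis
      using assms by (auto simp only: set_pmf_gap_kernel counter_pairs_eq image_insert gaps_update_00
          image_empty insert_iff empty_iff fst_conv snd_conv)
  next
    case (right k)
    then show ?thesis
      using assms by (auto simp only: set_pmf_gap_kernel counter_pairs_eq image_insert gaps_update_k0
          image_empty insert_iff empty_iff fst_conv snd_conv)
  next
    case (up l)
    then show ?thesis
      using assms by (auto simp only: set_pmf_gap_kernel counter_pairs_eq image_insert gaps_update_0l
          image_empty insert_iff empty_iff fst_conv snd_conv)
  next
    case (interior k l)
    then show ?thesis
      using assms by (auto simp only: set_pmf_gap_kernel counter_pairs_eq image_insert gaps_update_kl
          image_empty insert_iff empty_iff fst_conv snd_conv)
  qed
  then show "\<bar>real (fst y) - real (fst x)\<bar> \<le> 1" "\<bar>real (snd y) - real (snd x)\<bar> \<le> 1"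
    by simp_all
qed

context
  fixes A B C D :: "(nat \<times> nat) set"
  defines "A \<equiv> {(0, 0)}" and "B \<equiv> {(k, 0) | k. k \<ge> 1}"
    and "C \<equiv> {(0, l) | l. l \<ge> 1}" and "D \<equiv> {(k, l) | k l. k \<ge> 1 \<and> l \<ge> 1}"
begin

lemma fst_drift:
  "(\<integral>y. real (fst y) - real (fst x) \<partial>gap_kernel x) =
     indicator A x - 2/3 * indicator B x + 1/2 * indicator C x - 1/6 * indicator D x"
  unfolding integral_gap_kernel
  by (cases x rule: gap_cases)
     (simp_all only: sum_counter_pairs gaps_update_00 gaps_update_k0 gaps_update_0l gaps_update_kl,
      auto simp: A_def B_def C_def D_def indicator_def of_nat_diff)

lemma snd_drift:
  "(\<integral>y. real (snd y) - real (snd x) \<partial>gap_kernel x) =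
     2/3 * indicator B x - 1/2 * indicator C x - 1/6 * indicator D x"
  unfolding integral_gap_kernel
  by (cases x rule: gap_cases)
     (simp_all only: sum_counter_pairs gaps_update_00 gaps_update_k0 gaps_update_0l gaps_update_kl,
      auto simp: A_def B_def C_def D_def indicator_def of_nat_diff)

lemma gap_stationary_balance:
  defines "\<pi> \<equiv> measure gap_stationary"
  shows "\<pi> A - 2/3 * \<pi> B + 1/2 * \<pi> C - 1/6 * \<pi> D = 0"
    and "2/3 * \<pi> B - 1/2 * \<pi> C - 1/6 * \<pi> D = 0"
    and "\<pi> A + \<pi> B + \<pi> C + \<pi> D = 1"
proof -
  show "\<pi> A - 2/3 * \<pi> B + 1/2 * \<pi> C - 1/6 * \<pi> D = 0"
    using stationary_drift_zero[OF gap_stationary, of "\<lambda>g. real (fst g)" 1] gap_kernel_step_bounded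
    by (simp add: fst_drift \<pi>_def measure_pmf.emeasure_eq_measure)
  show "2/3 * \<pi> B - 1/2 * \<pi> C - 1/6 * \<pi> D = 0"
    using stationary_drift_zero[OF gap_stationary, of "\<lambda>g. real (snd g)" 1] gap_kernel_step_bounded
    by (simp add: snd_drift \<pi>_def measure_pmf.emeasure_eq_measure)
  have "(1 :: real) = indicator A g + indicator B g + indicator C g + indicator D g" for g
    by (cases g rule: gap_cases) (auto simp: A_def B_def C_def D_def indicator_def)
  then have "(\<integral>g. 1 \<partial>gap_stationary) =
      (\<integral>g. indicator A g + indicator B g + indicator C g + indicator D g \<partial>gap_stationary :: real)"
    by (intro Bochner_Integration.integral_cong) auto
  then show "\<pi> A + \<pi> B + \<pi> C + \<pi> D = 1"
    by (simp add: \<pi>_def measure_pmf.emeasure_eq_measure)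
qed

end

text \<open>The balance equations give \<open>V4 = 10/7 - 2/7 * a\<close> and \<open>b = (4 - 19 * a) / 7\<close>, where
  \<open>a\<close> and \<open>b\<close> are the stationary probabilities of the origin and of \<open>{(0, l) | l. l \<ge> 1}\<close>;
  the two bounds are \<open>a \<ge> 0\<close> and \<open>b \<ge> 0\<close>.\<close>

theorem mainTheorem4: "26 / 19 \<le> V4 \<and> V4 \<le> 10 / 7"
proof -
  have "0 \<le> measure gap_stationary {(0, 0)}" "0 \<le> measure gap_stationary {(0, l) | l. l \<ge> 1}"
    by simp_all
  then show ?thesis
    using gap_stationary_balance unfolding V4_eq by linarith
qed

end
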